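(* Let $\pi$ be a semigroup. (1) Let $(A,\prec,\succ)=(\{A_\varphi\}_{\varphi\in\pi},\{\prec_{p,q}\}_{p,q\in\pi},\{\succ_{p,q}\}_{p,q\in\pi})$ be a dendriform T-algebra. Then $(\{A_\varphi\}_{\varphi\in\pi},\{\diamond_{p,q}\}_{p,q\in\pi})$ is a T-algebra, where $\diamond_{p,q}:A_p\otimes A_q\to A_{pq}$ is given by $a\diamond_{p,q}b:=a\prec_{p,q}b+a\succ_{p,q}b$ for $a\in A_p$, $b\in A_q$. (2) Let $(A,\prec,\succ,\bullet)=(\{A_\varphi\}_{\varphi\in\pi},\{\prec_{p,q}\}_{p,q\in\pi},\{\succ_{p,q}\}_{p,q\in\pi},\{\bullet_{p,q}\}_{p,q\in\pi})$ be a tridendriform T-algebra. Then $(\{A_\varphi\}_{\varphi\in\pi},\{\diamond_{p,q}\}_{p,q\in\pi})$ is a T-algebra, where $\diamond_{p,q}:A_p\otimes A_q\to A_{pq}$ is given by $a\diamond_{p,q}b:=a\prec_{p,q}b+a\bullet_{p,q}b+a\succ_{p,q}b$ for $a\in A_p$, $b\in A_q$.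
   Context: $K$ is a field; all vector spaces, tensor products and linear maps are over $K$. For a semigroup $\pi$, a T-algebra is a family of vector spaces $\{A_\varphi\}_{\varphi\in\pi}$ with linear maps $\mu_{p,q}:A_p\otimes A_q\to A_{pq}$ ($p,q\in\pi$), written $\mu_{p,q}(a\otimes b)=a\cdot_{p,q}b$, such that $(a\cdot_{p,q}b)\cdot_{pq,t}c=a\cdot_{p,qt}(b\cdot_{q,t}c)$ for all $p,q,t\in\pi$, $a\in A_p,b\in A_q,c\in A_t$. A dendriform T-algebra is a family of vector spaces $\{A_\varphi\}_{\varphi\in\pi}$ with bilinear operations (linear maps) $\prec_{p,q},\succ_{p,q}:A_p\otimes A_q\to A_{pq}$ such that for all $p,q,t\in\pi$, $a\in A_p,b\in A_q,c\in A_t$: $(a\prec_{p,q}b)\prec_{pq,t}c=a\prec_{p,qt}(b\prec_{q,t}c+b\succ_{q,t}c)$; $(a\succ_{p,q}b)\prec_{pq,t}c=a\succ_{p,qt}(b\prec_{q,t}c)$; $(a\prec_{p,q}b+a\succ_{p,q}b)\succ_{pq,t}c=a\succ_{p,qt}(b\succ_{q,t}c)$. A tridendriform T-algebra is a family of vector spaces $\{A_\varphi\}_{\varphi\in\pi}$ with bilinear operations $\prec_{p,q},\succ_{p,q},\bullet_{p,q}:A_p\otimes A_q\to A_{pq}$ such that for all $p,q,t\in\pi$, $a\in A_p,b\in A_q,c\in A_t$: $(a\prec_{p,q}b)\prec_{pq,t}c=a\prec_{p,qt}(b\prec_{q,t}c+b\succ_{q,t}c+b\bullet_{q,t}c)$;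 $(a\succ_{p,q}b)\prec_{pq,t}c=a\succ_{p,qt}(b\prec_{q,t}c)$; $(a\prec_{p,q}b+a\succ_{p,q}b+a\bullet_{p,q}b)\succ_{pq,t}c=a\succ_{p,qt}(b\succ_{q,t}c)$; $(a\succ_{p,q}b)\bullet_{pq,t}c=a\succ_{p,qt}(b\bullet_{q,t}c)$; $(a\prec_{p,q}b)\bullet_{pq,t}c=a\bullet_{p,qt}(b\succ_{q,t}c)$; $(a\bullet_{p,q}b)\prec_{pq,t}c=a\bullet_{p,qt}(b\prec_{q,t}c)$; $(a\bullet_{p,q}b)\bullet_{pq,t}c=a\bullet_{p,qt}(b\bullet_{q,t}c)$. *)

theory Defs
  imports "Jordan_Normal_Form.Missing_VectorSpace"
begin

text \<open>
  The index semigroup is a type of class \<^class>\<open>semigroup_mult\<close>. Each member \<open>A p\<close> of a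
  family is a vector space with its own carrier, zero, addition and scalar multiplication. The
  members are not subspaces of a common vector space and their carriers need not be disjoint; only
  the underlying type of elements is shared.
\<close>

locale vectorspace_family =
  fixes K :: "('k, 'm) ring_scheme"
    and A :: "'p::semigroup_mult \<Rightarrow> ('k, 'v, 'n) module_scheme"
  assumes vectorspace: "vectorspace K (A p)"

text \<open>
  A linear map from the tensor product of \<open>A p\<close> and \<open>A q\<close> to \<open>A (p * q)\<close> is given by the
  corresponding bilinear map \<open>m p q\<close>, written in curried form. Its values outside the carriers
  are irrelevant.
\<close>

definition bilinear_operations ::
    "('k, 'm) ring_scheme \<Rightarrow> ('p::semigroup_mult \<Rightarrow> ('k, 'v, 'n) module_scheme) \<Rightarrow>
      ('p \<Rightarrow> 'p \<Rightarrow> 'v \<Rightarrow> 'v \<Rightarrow> 'v) \<Rightarrow> bool" where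
  "bilinear_operations K A m \<longleftrightarrow>
    (\<forall>p q. (\<forall>a\<in>carrier (A p). linear_map K (A q) (A (p * q)) (\<lambda>b. m p q a b)) \<and>
           (\<forall>b\<in>carrier (A q). linear_map K (A p) (A (p * q)) (\<lambda>a. m p q a b)))"

locale T_algebra = vectorspace_family K A
  for K :: "('k, 'm) ring_scheme"
    and A :: "'p::semigroup_mult \<Rightarrow> ('k, 'v, 'n) module_scheme" +
  fixes mu :: "'p \<Rightarrow> 'p \<Rightarrow> 'v \<Rightarrow> 'v \<Rightarrow> 'v"
  assumes bilinear: "bilinear_operations K A mu"
    and assoc:
      "\<lbrakk>a \<in> carrier (A p); b \<in> carrier (A q); c \<in> carrier (A t)\<rbrakk> \<Longrightarrow>
        mu (p * q) t (mu p q a b) c = mu p (q * t) a (mu q t b c)"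

locale dendriform_T_algebra = vectorspace_family K A
  for K :: "('k, 'm) ring_scheme"
    and A :: "'p::semigroup_mult \<Rightarrow> ('k, 'v, 'n) module_scheme" +
  fixes prec succ :: "'p \<Rightarrow> 'p \<Rightarrow> 'v \<Rightarrow> 'v \<Rightarrow> 'v"
  assumes bilinear_prec: "bilinear_operations K A prec"
    and bilinear_succ: "bilinear_operations K A succ"
    and prec_prec:
      "\<lbrakk>a \<in> carrier (A p); b \<in> carrier (A q); c \<in> carrier (A t)\<rbrakk> \<Longrightarrow>
        prec (p * q) t (prec p q a b) c =
        prec p (q * t) a (prec q t b c \<oplus>\<^bsub>A (q * t)\<^esub> succ q t b c)"
    and succ_prec:
      "\<lbrakk>a \<in> carrier (A p); b \<in> carrier (A q); c \<in> carrier (A t)\<rbrakk> \<Longrightarrow>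
        prec (p * q) t (succ p q a b) c = succ p (q * t) a (prec q t b c)"
    and succ_succ:
      "\<lbrakk>a \<in> carrier (A p); b \<in> carrier (A q); c \<in> carrier (A t)\<rbrakk> \<Longrightarrow>
        succ (p * q) t (prec p q a b \<oplus>\<^bsub>A (p * q)\<^esub> succ p q a b) c =
        succ p (q * t) a (succ q t b c)"

locale tridendriform_T_algebra = vectorspace_family K A
  for K :: "('k, 'm) ring_scheme"
    and A :: "'p::semigroup_mult \<Rightarrow> ('k, 'v, 'n) module_scheme" +
  fixes prec succ dot :: "'p \<Rightarrow> 'p \<Rightarrow> 'v \<Rightarrow> 'v \<Rightarrow> 'v"
  assumes bilinear_prec: "bilinear_operations K A prec"
    and bilinear_succ: "bilinear_operations K A succ"
    and bilinear_dot: "bilinear_operations K A dot"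
    and prec_prec:
      "\<lbrakk>a \<in> carrier (A p); b \<in> carrier (A q); c \<in> carrier (A t)\<rbrakk> \<Longrightarrow>
        prec (p * q) t (prec p q a b) c =
        prec p (q * t) a
          (prec q t b c \<oplus>\<^bsub>A (q * t)\<^esub> succ q t b c \<oplus>\<^bsub>A (q * t)\<^esub> dot q t b c)"
    and succ_prec:
      "\<lbrakk>a \<in> carrier (A p); b \<in> carrier (A q); c \<in> carrier (A t)\<rbrakk> \<Longrightarrow>
        prec (p * q) t (succ p q a b) c = succ p (q * t) a (prec q t b c)"
    and succ_succ:
      "\<lbrakk>a \<in> carrier (A p); b \<in> carrier (A q); c \<in> carrier (A t)\<rbrakk> \<Longrightarrow>
        succ (p * q) t
          (prec p q a b \<oplus>\<^bsub>A (p * q)\<^esub> succ p q a b \<oplus>\<^bsub>A (p * q)\<^esub> dot p q a b) c =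
        succ p (q * t) a (succ q t b c)"
    and succ_dot:
      "\<lbrakk>a \<in> carrier (A p); b \<in> carrier (A q); c \<in> carrier (A t)\<rbrakk> \<Longrightarrow>
        dot (p * q) t (succ p q a b) c = succ p (q * t) a (dot q t b c)"
    and prec_dot:
      "\<lbrakk>a \<in> carrier (A p); b \<in> carrier (A q); c \<in> carrier (A t)\<rbrakk> \<Longrightarrow>
        dot (p * q) t (prec p q a b) c = dot p (q * t) a (succ q t b c)"
    and dot_prec:
      "\<lbrakk>a \<in> carrier (A p); b \<in> carrier (A q); c \<in> carrier (A t)\<rbrakk> \<Longrightarrow>
        prec (p * q) t (dot p q a b) c = dot p (q * t) a (prec q t b c)"
    and dot_dot:
      "\<lbrakk>a \<in> carrier (A p); b \<in> carrier (A q); c \<in> carrier (A t)\<rbrakk> \<Longrightarrow>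
        dot (p * q) t (dot p q a b) c = dot p (q * t) a (dot q t b c)"

end

theory Submission
  imports Defs
begin

text \<open>
  Expanding both bracketings of \<open>a \<diamond> b \<diamond> c\<close> by bilinearity, every axiom identifies one summand (or
  the sum over all operations in one of the arguments) on the left with one on the right, so the
  sum of all the axioms is the associativity of \<open>\<diamond>\<close>.
\<close>

text \<open>Applied in each argument separately, this gives bilinearity of the total operation.
  Commutativity of addition in \<open>W\<close> regroups the four terms of additivity.\<close>

lemma linear_map_add:
  assumes f: "linear_map K V W f" and g: "linear_map K V W g"
  shows "linear_map K V W (\<lambda>v. f v \<oplus>\<^bsub>W\<^esub> g v)"
proof -
  have V: "vectorspace K V" and W: "vectorspace K W"
    using f by (simp_all add: linear_map_def)
  interpret W: vectorspace K W by (rule W)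
  have "(\<lambda>v. f v \<oplus>\<^bsub>W\<^esub> g v) \<in> module_hom K V W"
    using linear_map.T_im[OF f] linear_map.T_im[OF g] linear_map.T_add[OF f] linear_map.T_add[OF g]
      linear_map.T_smult[OF f] linear_map.T_smult[OF g]
    by (auto simp: module_hom_def W.a_ac W.smult_r_distr)
  with V W show ?thesis
    by (simp add: linear_map_def mod_hom_def mod_hom_axioms_def vectorspace_def)
qed

lemma bilinear_operations_add:
  assumes "bilinear_operations K A m" and "bilinear_operations K A n"
  shows "bilinear_operations K A (\<lambda>p q a b. m p q a b \<oplus>\<^bsub>A (p * q)\<^esub> n p q a b)"
  using assms unfolding bilinear_operations_def by (auto intro: linear_map_add)

lemma bilinear_operations_closed:
  assumes "bilinear_operations K A m" "a \<in> carrier (A p)" "b \<in> carrier (A q)"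
  shows "m p q a b \<in> carrier (A (p * q))"
  using assms by (auto simp: bilinear_operations_def dest: linear_map.T_im)

lemma bilinear_operations_add_left:
  assumes "bilinear_operations K A m"
    "a \<in> carrier (A p)" "a' \<in> carrier (A p)" "b \<in> carrier (A q)"
  shows "m p q (a \<oplus>\<^bsub>A p\<^esub> a') b = m p q a b \<oplus>\<^bsub>A (p * q)\<^esub> m p q a' b"
  using assms linear_map.T_add[of K "A p" "A (p * q)" "\<lambda>a. m p q a b" a a']
  by (simp add: bilinear_operations_def)

lemma bilinear_operations_add_right:
  assumes "bilinear_operations K A m"
    "a \<in> carrier (A p)" "b \<in> carrier (A q)" "b' \<in> carrier (A q)"
  shows "m p q a (b \<oplus>\<^bsub>A q\<^esub> b') = m p q a b \<oplus>\<^bsub>A (p * q)\<^esub> m p q a b'"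
  using assms by (auto simp: bilinear_operations_def dest: linear_map.T_add)

lemma (in vectorspace_family) abelian_group: "abelian_group (A p)"
  using vectorspace[of p] by (simp add: vectorspace_def module_def)

text \<open>Each bracketing expands to four summands. From left to right, \<open>prec_prec\<close>
  matches one with two, \<open>succ_prec\<close> one with one, and \<open>succ_succ\<close> two with
  one.\<close>

lemma (in dendriform_T_algebra) T_algebra_prec_succ:
  "T_algebra K A (\<lambda>p q a b. prec p q a b \<oplus>\<^bsub>A (p * q)\<^esub> succ p q a b)"
proof (unfold_locales, goal_cases)
  case 1
  show ?case by (intro bilinear_operations_add bilinear_prec bilinear_succ)
next
  case (2 a p b q c t)
  \<comment> \<open>By associativity of the semigroup both bracketings live in this one space, so
    all summands can be reordered there.\<close>
  interpret D: abelian_group "A (p * (q * t))" by (rule abelian_group)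
  note bil = bilinear_prec bilinear_succ
  note closed = bil[THEN bilinear_operations_closed]
  have closed3: "m p (q * t) a (n q t b c) \<in> carrier (A (p * (q * t)))"
    if "m \<in> {prec, succ}" "n \<in> {prec, succ}" for m n
    using that 2 by (auto intro!: closed)
  show ?case
    using 2 prec_prec[OF 2] succ_prec[OF 2] succ_succ[OF 2]
    by (simp add: closed closed3 bil[THEN bilinear_operations_add_left]
        bil[THEN bilinear_operations_add_right] mult.assoc D.a_ac)
qed

text \<open>Now there are nine summands on each side: \<open>prec_prec\<close> matches one with
  three, \<open>succ_succ\<close> three with one, and the other five axioms one with one.\<close>

lemma (in tridendriform_T_algebra) T_algebra_prec_dot_succ:
  "T_algebra K A
    (\<lambda>p q a b. prec p q a b \<oplus>\<^bsub>A (p * q)\<^esub> dot p q a b \<oplus>\<^bsub>A (p * q)\<^esub> succ p q a b)"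
proof (unfold_locales, goal_cases)
  case 1
  show ?case by (intro bilinear_operations_add bilinear_prec bilinear_dot bilinear_succ)
next
  case (2 a p b q c t)
  interpret D: abelian_group "A (p * (q * t))" by (rule abelian_group)
  \<comment> \<open>Splitting a threefold sum inside an argument needs its partial sums to lie in
    the carrier, hence closure under addition in \<open>A (p * q)\<close> and
    \<open>A (q * t)\<close>.\<close>
  interpret PQ: abelian_group "A (p * q)" by (rule abelian_group)
  interpret QT: abelian_group "A (q * t)" by (rule abelian_group)
  note bil = bilinear_prec bilinear_dot bilinear_succ
  note closed = bil[THEN bilinear_operations_closed]
  have closed3: "m p (q * t) a (n q t b c) \<in> carrier (A (p * (q * t)))"
    if "m \<in> {prec, dot, succ}" "n \<in> {prec, dot, succ}" for m n
    using that 2 by (auto intro!: closed)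
  \<comment> \<open>These left-bracketed products survive in the normal form, because
    \<open>succ_succ\<close> is used from right to left below: its single right-hand product expands
    into three of them.\<close>
  have closed_succ: "succ (p * q) t (n p q a b) c \<in> carrier (A (p * (q * t)))"
    if "n \<in> {prec, dot, succ}" for n
    using that 2 closed(3)[of "n p q a b" "p * q" c t] by (auto simp: mult.assoc closed)
  show ?case
    using 2 prec_prec[OF 2] succ_prec[OF 2]
      succ_dot[OF 2] prec_dot[OF 2] dot_prec[OF 2] dot_dot[OF 2]
    by (simp add: succ_succ[OF 2, symmetric] closed closed3 closed_succ bil[THEN bilinear_operations_add_left]
        bil[THEN bilinear_operations_add_right] mult.assoc D.a_ac)
qed

theorem proposition2p28:
  fixes K :: "('k, 'm) ring_scheme"
    and A :: "'p::semigroup_mult \<Rightarrow> ('k, 'v, 'n) module_scheme"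
  shows "(\<forall>prec succ. dendriform_T_algebra K A prec succ \<longrightarrow>
            T_algebra K A (\<lambda>p q a b. prec p q a b \<oplus>\<^bsub>A (p * q)\<^esub> succ p q a b)) \<and>
         (\<forall>prec succ dot. tridendriform_T_algebra K A prec succ dot \<longrightarrow>
            T_algebra K A
              (\<lambda>p q a b. prec p q a b \<oplus>\<^bsub>A (p * q)\<^esub> dot p q a b \<oplus>\<^bsub>A (p * q)\<^esub> succ p q a b))"
  by (blast intro: dendriform_T_algebra.T_algebra_prec_succ
      tridendriform_T_algebra.T_algebra_prec_dot_succ)

end
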